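(* Let $\lambda = (\lambda_1,\dots,\lambda_n) \in \mathbb{Z}_+^n$, let $r \in \mathbb{Z}_+$, and define $d(\lambda) := \left\lfloor \sum_{i=1}^n \frac{1}{\lambda_i} \right\rfloor$. If $r \ge n - d(\lambda)$, then $r\Delta(\lambda)$ is normal.
   Context: $\mathbb{Z}_+$ is the set of positive integers. For $\lambda\in\mathbb{Z}_+^n$, the rectangular simplex $\Delta(\lambda) \subset \mathbb{R}^n$ is the convex hull of $\{0,\lambda_1 e_1,\dots,\lambda_n e_n\}$, where $e_1,\dots,e_n$ is the standard basis. For a polytope $P$ and $r \in \mathbb{Z}_+$, $rP = \{x : x/r \in P\}$. A lattice polytope $P \subset \mathbb{R}^n$ is normal if for every integer $k \ge 1$ and every $x \in kP \cap \mathbb{Z}^n$ there exist $x_1,\dots,x_k \in P\cap\mathbb{Z}^n$ with $x = x_1+\cdots+x_k$. *)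

theory Defs
  imports "HOL-Analysis.Analysis"
begin

definition lattice_points :: "(real ^ 'n) set" where
  "lattice_points = {x. \<forall>i. x $ i \<in> \<int>}"

definition lattice_polytope :: "(real ^ 'n) set \<Rightarrow> bool" where
  "lattice_polytope P \<longleftrightarrow>
     (\<exists>V. finite V \<and> V \<subseteq> lattice_points \<and> P = convex hull V)"

definition dilate :: "nat \<Rightarrow> (real ^ 'n) set \<Rightarrow> (real ^ 'n) set" where
  "dilate r P = {x. x /\<^sub>R real r \<in> P}"

text \<open>Normality is a notion for lattice polytopes only, so being a lattice polytope is part of it.\<close>

definition normal_polytope :: "(real ^ 'n) set \<Rightarrow> bool" where
  "normal_polytope P \<longleftrightarrow> lattice_polytope P \<and>
     (\<forall>k\<ge>1. \<forall>x \<in> dilate k P \<inter> lattice_points.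
        \<exists>y :: nat \<Rightarrow> real ^ 'n.
          (\<forall>j\<in>{1..k}. y j \<in> P \<inter> lattice_points) \<and> x = (\<Sum>j=1..k. y j))"

definition rect_simplex :: "nat ^ 'n \<Rightarrow> (real ^ 'n) set" where
  "rect_simplex l = convex hull (insert 0 (range (\<lambda>i. real (l $ i) *\<^sub>R axis i 1)))"

definition recip_floor :: "nat ^ 'n \<Rightarrow> int" where
  "recip_floor l = \<lfloor>\<Sum>i\<in>UNIV. 1 / real (l $ i)\<rfloor>"

end

theory Submission imports Defs begin

text \<open>
  In weight coordinates \<open>r\<Delta>(\<lambda>)\<close> consists of the \<open>x \<ge> 0\<close> with \<open>w(x) = \<Sum> x\<^sub>i/\<lambda>\<^sub>i \<le> r\<close>.
  A lattice point \<open>x \<ge> 0\<close> with all \<open>x\<^sub>i \<le> \<lambda>\<^sub>i - 1\<close> has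
  \<open>w(x) \<le> n - \<Sum> 1/\<lambda>\<^sub>i \<le> n - d(\<lambda>) \<le> r\<close>. Hence as long as \<open>w(x) > r\<close> one can subtract some
  \<open>\<lambda>\<^sub>i e\<^sub>i\<close>, which lowers the weight by exactly 1. Doing so
  splits off from any lattice point of weight at most \<open>s \<ge> r\<close> a lattice point of \<open>r\<Delta>(\<lambda>)\<close> whose
  complement has weight at most \<open>s - r\<close>; iterate with \<open>s = kr\<close>.
\<close>

text \<open>The inequalities cut out a convex set containing the generators, so it contains the
  hull. Conversely, \<open>x $ i / real (l $ i)\<close> serve as convex coefficients, and the slack
  in the weight inequality goes to the vertex 0.\<close>

lemma rect_simplex_iff:
  fixes l :: "nat ^ 'n"
  assumes l: "\<And>i. l $ i > 0"
  shows "x \<in> rect_simplex l \<longleftrightarrow> (\<forall>i. x $ i \<ge> 0) \<and> (\<Sum>i\<in>UNIV. x $ i / real (l $ i)) \<le> 1"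
proof -
  let ?S = "{x :: real ^ 'n. (\<forall>i. x $ i \<ge> 0) \<and> (\<Sum>i\<in>UNIV. x $ i / real (l $ i)) \<le> 1}"
  have "convex ?S"
  proof (rule convexI)
    fix x y :: "real ^ 'n" and u v :: real
    assume x: "x \<in> ?S" and y: "y \<in> ?S" and uv: "u \<ge> 0" "v \<ge> 0" "u + v = 1"
    have "(\<Sum>i\<in>UNIV. (u *\<^sub>R x + v *\<^sub>R y) $ i / real (l $ i))
        = u * (\<Sum>i\<in>UNIV. x $ i / real (l $ i)) + v * (\<Sum>i\<in>UNIV. y $ i / real (l $ i))"
      by (simp add: sum_distrib_left sum.distrib[symmetric] add_divide_distrib)
    also have "\<dots> \<le> u * 1 + v * 1"
      using x y uv by (intro add_mono mult_left_mono) auto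
    finally show "u *\<^sub>R x + v *\<^sub>R y \<in> ?S" using x y uv by auto
  qed
  moreover have "insert 0 (range (\<lambda>i. real (l $ i) *\<^sub>R axis i 1)) \<subseteq> ?S"
  proof -
    have "(\<Sum>j\<in>UNIV. (real (l $ i) *\<^sub>R axis i 1) $ j / real (l $ j)) = 1" for i
    proof -
      have "(\<Sum>j\<in>UNIV. (real (l $ i) *\<^sub>R axis i 1) $ j / real (l $ j))
          = (\<Sum>j\<in>UNIV. if j = i then 1 else 0)"
        by (rule sum.cong) (use l[of i] in \<open>auto simp: axis_def\<close>)
      then show ?thesis by simp
    qed
    then show ?thesis by (auto simp: axis_def)
  qed
  ultimately have "rect_simplex l \<subseteq> ?S"
    unfolding rect_simplex_def by (rule hull_minimal[rotated])
  moreover have "x \<in> rect_simplex l" if x: "x \<in> ?S"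
  proof -
    \<comment> \<open>The \<open>n + 1\<close> vertices are indexed by \<open>'n option\<close>:
      \<open>None\<close> stands for the origin, which absorbs the missing mass
      \<open>1 - sum c UNIV\<close>.\<close>
    define c where "c i = x $ i / real (l $ i)" for i
    define a where "a = case_option (1 - sum c UNIV) c"
    define v where "v = case_option 0 (\<lambda>i. real (l $ i) *\<^sub>R axis i (1::real))"
    have sum_option: "(\<Sum>j\<in>UNIV. f j) = f None + (\<Sum>i\<in>UNIV. f (Some i))"
      for f :: "'n option \<Rightarrow> 'b::comm_monoid_add"
      by (simp add: UNIV_option_conv sum.reindex)
    have "(\<Sum>j\<in>UNIV. a j *\<^sub>R v j) \<in> rect_simplex l"
    proof (rule convex_sum)
      show "convex (rect_simplex l)"
        unfolding rect_simplex_def by (rule convex_convex_hull)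
      show "sum a UNIV = 1" by (simp add: sum_option a_def)
      show "a j \<ge> 0" for j
        using x by (cases j) (auto simp: a_def c_def)
      show "v j \<in> rect_simplex l" for j
        unfolding rect_simplex_def by (rule hull_inc) (auto simp: v_def split: option.split)
    qed simp
    moreover have "(\<Sum>j\<in>UNIV. a j *\<^sub>R v j) = x"
    proof -
      have "(\<Sum>j\<in>UNIV. a j *\<^sub>R v j) = (\<Sum>i\<in>UNIV. x $ i *\<^sub>R axis i 1)"
        using l by (simp add: sum_option a_def v_def c_def)
      also have "\<dots> = x"
        by (simp add: vec_eq_iff axis_def if_distrib cong: if_cong)
      finally show ?thesis .
    qed
    ultimately show ?thesis by simp
  qed
  ultimately show ?thesis by blast
qed

lemma dilate_eq_image:
  assumes "r > 0"
  shows "dilate r P = (*\<^sub>R) (real r) ` P"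
proof
  show "dilate r P \<subseteq> (*\<^sub>R) (real r) ` P"
  proof
    fix x assume "x \<in> dilate r P"
    then show "x \<in> (*\<^sub>R) (real r) ` P"
      using assms by (intro image_eqI[of _ _ "x /\<^sub>R real r"]) (auto simp: dilate_def)
  qed
qed (use assms in \<open>auto simp: dilate_def\<close>)

lemma dilate_dilate: "dilate k (dilate r P) = dilate (k * r) P"
  by (simp add: dilate_def mult.commute)

lemma dilate_rect_simplex_iff:
  fixes l :: "nat ^ 'n"
  assumes l: "\<And>i. l $ i > 0" and r: "r > 0"
  shows "x \<in> dilate r (rect_simplex l) \<longleftrightarrow>
    (\<forall>i. x $ i \<ge> 0) \<and> (\<Sum>i\<in>UNIV. x $ i / real (l $ i)) \<le> real r"
proof -
  have "(\<Sum>i\<in>UNIV. (x /\<^sub>R real r) $ i / real (l $ i)) = (\<Sum>i\<in>UNIV. x $ i / real (l $ i)) / real r"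
    by (simp add: sum_divide_distrib field_simps)
  then show ?thesis
    using r by (simp add: dilate_def rect_simplex_iff[OF l] zero_le_mult_iff pos_divide_le_eq)
qed

lemma lattice_polytope_dilate_rect_simplex:
  assumes "r > 0"
  shows "lattice_polytope (dilate r (rect_simplex l))"
proof -
  let ?V = "(*\<^sub>R) (real r) ` insert 0 (range (\<lambda>i. real (l $ i) *\<^sub>R axis i 1))"
  have "dilate r (rect_simplex l) = convex hull ?V"
    \<comment> \<open>The vertex set must stay a scaled image, the form in which scaling commutes
      with the hull.\<close>
    using assms by (simp add: dilate_eq_image rect_simplex_def convex_hull_scaling del: image_insert)
  moreover have "?V \<subseteq> lattice_points"
    by (auto simp: lattice_points_def axis_def)
  moreover have "finite ?V" by simp
  ultimately show ?thesis unfolding lattice_polytope_def by blast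
qed

lemma nonneg_lattice_point_conv:
  fixes x :: "real ^ 'n"
  assumes "x \<in> lattice_points" "\<And>i. x $ i \<ge> 0"
  obtains a :: "'n \<Rightarrow> nat" where "x = (\<chi> i. real (a i))"
proof -
  have "\<exists>m. x $ i = real m" for i
    using assms by (auto simp: lattice_points_def Nats_altdef2 intro: Nats_cases[of "x $ i"])
  then obtain a where "\<And>i. x $ i = real (a i)" by metis
  then show thesis by (intro that[of a]) (simp add: vec_eq_iff)
qed

text \<open>The linear functional equal to 1 on the facet opposite the origin. Natural coordinates
  build in integrality and nonnegativity.\<close>

definition weight :: "nat ^ 'n \<Rightarrow> ('n \<Rightarrow> nat) \<Rightarrow> real" where
  "weight l a = (\<Sum>i\<in>UNIV. real (a i) / real (l $ i))"

lemma weight_add: "weight l (\<lambda>i. a i + b i) = weight l a + weight l b"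
  by (simp add: weight_def sum.distrib add_divide_distrib)

lemma weight_single:
  assumes "l $ j > 0"
  shows "weight l (\<lambda>i. if i = j then l $ j else 0) = 1"
proof -
  have "weight l (\<lambda>i. if i = j then l $ j else 0) = (\<Sum>i\<in>UNIV. if i = j then 1 else 0)"
    unfolding weight_def by (rule sum.cong) (use assms in auto)
  then show ?thesis by simp
qed

lemma weight_nonpos_imp_zero:
  fixes l :: "nat ^ 'n"
  assumes "\<And>i. l $ i > 0" "weight l a \<le> 0"
  shows "a = (\<lambda>_. 0)"
proof -
  have "weight l a = 0"
    using assms(2) by (intro antisym) (simp_all add: weight_def sum_nonneg)
  then have "real (a i) / real (l $ i) = 0" for i
    unfolding weight_def by (subst (asm) sum_nonneg_eq_0_iff) auto
  moreover have "l $ i \<noteq> 0" for i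
    using assms(1)[of i] by simp
  ultimately show ?thesis by (simp add: fun_eq_iff)
qed

lemma weight_reduced_le:
  fixes l :: "nat ^ 'n"
  assumes "\<And>i. a i < l $ i"
  shows "weight l a \<le> real_of_int (int CARD('n) - recip_floor l)"
proof -
  have "weight l a \<le> (\<Sum>i\<in>UNIV. 1 - 1 / real (l $ i))"
    unfolding weight_def
  proof (rule sum_mono)
    fix i
    \<comment> \<open>Integrality enters here: the strict inequality leaves a gap of a full unit in
      each coordinate.\<close>
    have "real (a i) + 1 \<le> real (l $ i)" "real (l $ i) > 0"
      using assms[of i] by linarith+
    then show "real (a i) / real (l $ i) \<le> 1 - 1 / real (l $ i)"
      by (simp add: field_simps)
  qed
  also have "\<dots> = real CARD('n) - (\<Sum>i\<in>UNIV. 1 / real (l $ i))"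
    by (simp add: sum_subtractf)
  also have "\<dots> \<le> real_of_int (int CARD('n) - recip_floor l)"
    by (simp add: recip_floor_def)
  finally show ?thesis .
qed

text \<open>Induction on the excess \<open>m\<close> over \<open>r\<close>, in unit steps because
  removing one vertex \<open>l $ j\<close> times \<open>e_j\<close> lowers the weight by 1. The part
  \<open>c\<close> collects the removed vertices and \<open>b\<close> is what remains.\<close>

lemma weight_split:
  fixes l :: "nat ^ 'n"
  assumes l: "\<And>i. l $ i > 0" and r: "int r \<ge> int CARD('n) - recip_floor l"
    and "weight l a \<le> real (m + r)"
  shows "\<exists>b c. a = (\<lambda>i. b i + c i) \<and> weight l b \<le> real r \<and> weight l c \<le> real m"
  using assms(3)
proof (induction m arbitrary: a)
  case 0
  then show ?case
    by (intro exI[of _ a] exI[of _ "\<lambda>_. 0"]) (auto simp: weight_def)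
next
  case (Suc m)
  show ?case
  proof (cases "weight l a \<le> real r")
    case True
    then show ?thesis
      by (intro exI[of _ a] exI[of _ "\<lambda>_. 0"]) (auto simp: weight_def)
  next
    case False
    have "\<exists>j. l $ j \<le> a j"
    proof (rule ccontr)
      assume "\<nexists>j. l $ j \<le> a j"
      then have "weight l a \<le> real_of_int (int CARD('n) - recip_floor l)"
        by (intro weight_reduced_le) (simp add: not_le)
      also have "\<dots> \<le> real_of_int (int r)"
        using r by (simp only: of_int_le_iff)
      finally show False using False by simp
    qed
    then obtain j where j: "l $ j \<le> a j" ..
    let ?e = "\<lambda>i. if i = j then l $ j else 0"
    \<comment> \<open>Subtraction on naturals truncates; the choice of \<open>j\<close> makes it
      exact here.\<close>
    have a: "(\<lambda>i. (a i - ?e i) + ?e i) = a"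
      using j by auto
    have "weight l a = weight l (\<lambda>i. a i - ?e i) + 1"
      using weight_add[of l "\<lambda>i. a i - ?e i" ?e] l unfolding a by (simp add: weight_single)
    with Suc.prems have "weight l (\<lambda>i. a i - ?e i) \<le> real (m + r)" by simp
    from Suc.IH[OF this] obtain b c where bc: "(\<lambda>i. a i - ?e i) = (\<lambda>i. b i + c i)"
      "weight l b \<le> real r" "weight l c \<le> real m" by blast
    \<comment> \<open>The removed vertex is credited to \<open>c\<close>, whose allowance grows from
      \<open>m\<close> to \<open>Suc m\<close>; \<open>b\<close> keeps its bound
      \<open>r\<close>.\<close>
    have "a = (\<lambda>i. b i + (c i + ?e i))"
    proof
      fix i
      show "a i = b i + (c i + ?e i)"
        using fun_cong[OF a, of i] fun_cong[OF bc(1), of i] by linarith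
    qed
    moreover have "weight l (\<lambda>i. c i + ?e i) \<le> real (Suc m)"
      using bc(3) weight_single[of l j] l by (simp add: weight_add)
    ultimately show ?thesis
      using bc(2) by (intro exI[of _ b] exI[of _ "\<lambda>i. c i + ?e i"] conjI)
  qed
qed

text \<open>Each application of \<open>weight_split\<close> with excess \<open>k * r\<close> peels
  off one summand of weight at most \<open>r\<close> and leaves a remainder for the induction. At
  \<open>k = 0\<close> the weight bound forces \<open>a\<close> to vanish, matching the empty
  sum.\<close>

lemma weight_decompose:
  fixes l :: "nat ^ 'n"
  assumes l: "\<And>i. l $ i > 0" and r: "int r \<ge> int CARD('n) - recip_floor l"
    and "weight l a \<le> real (k * r)"
  shows "\<exists>b. (\<forall>j\<in>{1..k}. weight l (b j) \<le> real r) \<and> (\<forall>i. a i = (\<Sum>j=1..k. b j i))"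
  using assms(3)
proof (induction k arbitrary: a)
  case 0
  then show ?case using weight_nonpos_imp_zero[OF l, of a] by simp
next
  case (Suc k)
  have "weight l a \<le> real (k * r + r)" using Suc.prems by (simp add: algebra_simps)
  from weight_split[OF l r this] obtain y c where yc: "a = (\<lambda>i. y i + c i)"
    "weight l y \<le> real r" "weight l c \<le> real (k * r)" by blast
  from Suc.IH[OF yc(3)] obtain b where b: "\<forall>j\<in>{1..k}. weight l (b j) \<le> real r"
    "\<forall>i. c i = (\<Sum>j=1..k. b j i)" by blast
  \<comment> \<open>The new summand sits at index \<open>Suc k\<close>, outside the range of the old
    sum.\<close>
  have "(\<Sum>j=1..k. (b(Suc k := y)) j i) = (\<Sum>j=1..k. b j i)" for i
    by (rule sum.cong) auto
  then show ?case
    using b yc by (intro exI[of _ "b(Suc k := y)"]) (auto simp: le_Suc_eq)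
qed

theorem proposition1p4:
  fixes l :: "nat ^ 'n" and r :: nat
  assumes "\<And>i. l $ i > 0" and "r > 0"
    and "int r \<ge> int CARD('n) - recip_floor l"
  shows "normal_polytope (dilate r (rect_simplex l))"
  unfolding normal_polytope_def
proof (intro conjI allI impI ballI)
  show "lattice_polytope (dilate r (rect_simplex l))"
    using assms(2) by (rule lattice_polytope_dilate_rect_simplex)
next
  fix k :: nat and x
  assume k: "1 \<le> k" and x: "x \<in> dilate k (dilate r (rect_simplex l)) \<inter> lattice_points"
  \<comment> \<open>The iterated dilation is a single one by \<open>k * r\<close>, so the inequality
    description of a positive dilate applies directly.\<close>
  have "k * r > 0" using k assms(2) by simp
  with x have nonneg: "\<And>i. x $ i \<ge> 0" and le: "(\<Sum>i\<in>UNIV. x $ i / real (l $ i)) \<le> real (k * r)"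
    using dilate_rect_simplex_iff[OF assms(1), of "k * r" x] by (auto simp: dilate_dilate)
  obtain a where a: "x = (\<chi> i. real (a i))"
    using nonneg_lattice_point_conv x nonneg by blast
  have "weight l a \<le> real (k * r)" using le by (simp add: a weight_def)
  from weight_decompose[OF assms(1,3) this] obtain b
    where b: "\<forall>j\<in>{1..k}. weight l (b j) \<le> real r" "\<forall>i. a i = (\<Sum>j=1..k. b j i)" by blast
  show "\<exists>y. (\<forall>j\<in>{1..k}. y j \<in> dilate r (rect_simplex l) \<inter> lattice_points) \<and> x = (\<Sum>j=1..k. y j)"
  proof (intro exI conjI ballI)
    show "(\<chi> i. real (b j i)) \<in> dilate r (rect_simplex l) \<inter> lattice_points" if "j \<in> {1..k}" for j
      using b(1) that dilate_rect_simplex_iff[OF assms(1,2)]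
      by (auto simp: lattice_points_def weight_def)
    show "x = (\<Sum>j=1..k. \<chi> i. real (b j i))"
      by (simp add: a vec_eq_iff b(2))
  qed
qed

end
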